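(* Let $\langle D;<\rangle$ be a (strict) linear order. Then $\langle D;<\rangle$ satisfies the scheme $\mathtt{D\text{-}Inf}$ if and only if it satisfies the scheme $\mathtt{DCI}$.
   Context: Formulas are first-order formulas in the language $\{<\}$; a scheme holds in a structure if every instance (with further free variables read universally, as parameters) is true in it. $\mathtt{D\text{-}Inf}$ is the scheme $$\exists x\,\varphi(x)\wedge\exists y\,\forall x\,[\varphi(x)\rightarrow y\leqslant x]\longrightarrow\exists z\,\forall y\,\big(\forall x\,[\varphi(x)\rightarrow y\leqslant x]\leftrightarrow y\leqslant z\big),$$ and $\mathtt{DCI}$ is the scheme $$\exists x\,\forall y\!<\!x\,\varphi(y)\;\wedge\;\forall x\big[\forall y\!<\!x\,\varphi(y)\rightarrow\exists z\!>\!x\,\forall y\!<\!z\,\varphi(y)\big]\longrightarrow\forall x\,\varphi(x),$$ for arbitrary formulas $\varphi$. *)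

theory Defs
  imports Main
begin

text \<open>
  First-order formulas (with equality) in the language of one binary relation symbol,
  with de Bruijn indices for variables: index \<open>0\<close> refers to the innermost enclosing quantifier.
\<close>

datatype fm =
    Less nat nat
  | Equal nat nat
  | Neg fm
  | And fm fm
  | Or fm fm
  | Imp fm fm
  | Iff fm fm
  | All fm
  | Ex fm

primrec sat :: "'a set \<Rightarrow> ('a \<Rightarrow> 'a \<Rightarrow> bool) \<Rightarrow> (nat \<Rightarrow> 'a) \<Rightarrow> fm \<Rightarrow> bool" where
  "sat D lt e (Less i j) \<longleftrightarrow> lt (e i) (e j)"
| "sat D lt e (Equal i j) \<longleftrightarrow> e i = e j"
| "sat D lt e (Neg p) \<longleftrightarrow> \<not> sat D lt e p"
| "sat D lt e (And p q) \<longleftrightarrow> sat D lt e p \<and> sat D lt e q"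
| "sat D lt e (Or p q) \<longleftrightarrow> sat D lt e p \<or> sat D lt e q"
| "sat D lt e (Imp p q) \<longleftrightarrow> (sat D lt e p \<longrightarrow> sat D lt e q)"
| "sat D lt e (Iff p q) \<longleftrightarrow> (sat D lt e p \<longleftrightarrow> sat D lt e q)"
| "sat D lt e (All p) \<longleftrightarrow> (\<forall>d\<in>D. sat D lt (case_nat d e) p)"
| "sat D lt e (Ex p) \<longleftrightarrow> (\<exists>d\<in>D. sat D lt (case_nat d e) p)"

text \<open>Renaming of free variables; the index of a newly entered quantifier is kept fixed.\<close>

primrec rename :: "(nat \<Rightarrow> nat) \<Rightarrow> fm \<Rightarrow> fm" where
  "rename r (Less i j) = Less (r i) (r j)"
| "rename r (Equal i j) = Equal (r i) (r j)"
| "rename r (Neg p) = Neg (rename r p)"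
| "rename r (And p q) = And (rename r p) (rename r q)"
| "rename r (Or p q) = Or (rename r p) (rename r q)"
| "rename r (Imp p q) = Imp (rename r p) (rename r q)"
| "rename r (Iff p q) = Iff (rename r p) (rename r q)"
| "rename r (All p) = All (rename (case_nat 0 (\<lambda>n. Suc (r n))) p)"
| "rename r (Ex p) = Ex (rename (case_nat 0 (\<lambda>n. Suc (r n))) p)"

text \<open>
  In a formula \<open>\<phi>(x)\<close> the distinguished variable \<open>x\<close> is index \<open>0\<close>, and the parameters are the
  indices \<open>1, 2, \<dots>\<close>. The formula \<open>inst k i \<phi>\<close> is \<open>\<phi>\<close> applied to the variable with index \<open>i\<close>,
  placed under \<open>k\<close> quantifiers: the parameters are shifted so that those quantifiers do not
  capture them.
\<close>

definition inst :: "nat \<Rightarrow> nat \<Rightarrow> fm \<Rightarrow> fm" where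
  "inst k i \<phi> = rename (case_nat i (\<lambda>n. n + k)) \<phi>"

definition Leq :: "nat \<Rightarrow> nat \<Rightarrow> fm" where
  "Leq i j = Or (Less i j) (Equal i j)"

text \<open>
  Bounded quantifiers \<open>\<forall>y<v. p\<close> and \<open>\<exists>y>v. p\<close>. The index \<open>i\<close> of the bound \<open>v\<close> is counted
  outside the quantifier, whereas \<open>p\<close> lives inside it.
\<close>

definition All_below :: "nat \<Rightarrow> fm \<Rightarrow> fm" where
  "All_below i p = All (Imp (Less 0 (Suc i)) p)"

definition Ex_above :: "nat \<Rightarrow> fm \<Rightarrow> fm" where
  "Ex_above i p = Ex (And (Less (Suc i) 0) p)"

definition D_Inf :: "fm \<Rightarrow> fm" where
  "D_Inf \<phi> =
    Imp (And (Ex (inst 1 0 \<phi>))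
             (Ex (All (Imp (inst 2 0 \<phi>) (Leq 1 0)))))
        (Ex (All (Iff (All (Imp (inst 3 0 \<phi>) (Leq 1 0))) (Leq 0 1))))"

definition DCI :: "fm \<Rightarrow> fm" where
  "DCI \<phi> =
    Imp (And (Ex (All_below 0 (inst 2 0 \<phi>)))
             (All (Imp (All_below 0 (inst 2 0 \<phi>))
                       (Ex_above 0 (All_below 0 (inst 3 0 \<phi>))))))
        (All (inst 1 0 \<phi>))"

definition satisfies_scheme ::
  "'a set \<Rightarrow> ('a \<Rightarrow> 'a \<Rightarrow> bool) \<Rightarrow> (fm \<Rightarrow> fm) \<Rightarrow> bool" where
  "satisfies_scheme D lt S \<longleftrightarrow> (\<forall>\<phi> e. range e \<subseteq> D \<longrightarrow> sat D lt e (S \<phi>))"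

end

theory Submission
  imports Defs
begin

text \<open>
  For D-Inf to DCI, take the infimum of the counterexamples to \<open>\<phi>\<close>: every element below it
  satisfies \<open>\<phi>\<close>, so progressivity yields a strictly greater lower bound. Conversely, if \<open>\<phi>\<close> is
  inhabited and bounded below but has no infimum, then "is a lower bound of \<open>\<phi>\<close>" satisfies
  the premises of DCI, so that every element of \<open>\<phi>\<close> is a lower bound of \<open>\<phi>\<close>, hence its
  minimum.
\<close>

text \<open>Generalising over \<open>e\<close> and \<open>r\<close> is essential: under a quantifier
  both are extended at index 0, and the two extensions compose to the extension of the
  composite.\<close>

lemma sat_rename: "sat D lt e (rename r p) \<longleftrightarrow> sat D lt (\<lambda>n. e (r n)) p"
proof (induction p arbitrary: e r)
  case (All p)
  have "(\<lambda>n. case_nat d e (case_nat 0 (\<lambda>n. Suc (r n)) n)) = case_nat d (\<lambda>n. e (r n))" for d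
    by (auto split: nat.split)
  then show ?case by (simp add: All)
next
  case (Ex p)
  have "(\<lambda>n. case_nat d e (case_nat 0 (\<lambda>n. Suc (r n)) n)) = case_nat d (\<lambda>n. e (r n))" for d
    by (auto split: nat.split)
  then show ?case by (simp add: Ex)
qed simp_all

lemma sat_inst: "sat D lt e (inst k i \<phi>) \<longleftrightarrow> sat D lt (case_nat (e i) (\<lambda>n. e (n + k))) \<phi>"
proof -
  have "(\<lambda>n. e (case_nat i (\<lambda>n. n + k) n)) = case_nat (e i) (\<lambda>n. e (n + k))"
    by (auto split: nat.split)
  then show ?thesis by (simp add: inst_def sat_rename)
qed

lemma sat_Leq: "sat D lt e (Leq i j) \<longleftrightarrow> lt\<^sup>=\<^sup>= (e i) (e j)"
  by (simp add: Leq_def)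

text \<open>Together with \<open>sat_DCI\<close> this removes the de Bruijn bookkeeping: afterwards
  the formula enters only through the predicate \<open>P\<close> on \<open>D\<close>, with its
  parameters fixed by \<open>e\<close>.\<close>

lemma sat_D_Inf:
  "sat D lt e (D_Inf \<phi>) \<longleftrightarrow>
    (let P = \<lambda>x. sat D lt (case_nat x e) \<phi>; lb = \<lambda>y. \<forall>x\<in>D. P x \<longrightarrow> lt\<^sup>=\<^sup>= y x
     in (\<exists>x\<in>D. P x) \<and> (\<exists>y\<in>D. lb y) \<longrightarrow> (\<exists>z\<in>D. \<forall>y\<in>D. lb y \<longleftrightarrow> lt\<^sup>=\<^sup>= y z))"
  by (simp add: D_Inf_def sat_inst sat_Leq Let_def numeral_2_eq_2 numeral_3_eq_3)

lemma sat_DCI: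
  "sat D lt e (DCI \<phi>) \<longleftrightarrow>
    (let P = \<lambda>x. sat D lt (case_nat x e) \<phi>; below = \<lambda>x. \<forall>y\<in>D. lt y x \<longrightarrow> P y
     in (\<exists>x\<in>D. below x) \<and> (\<forall>x\<in>D. below x \<longrightarrow> (\<exists>z\<in>D. lt x z \<and> below z)) \<longrightarrow> (\<forall>x\<in>D. P x))"
  by (simp add: DCI_def All_below_def Ex_above_def sat_inst Let_def numeral_2_eq_2 numeral_3_eq_3)

context
  fixes D :: "'a set" and lt :: "'a \<Rightarrow> 'a \<Rightarrow> bool"
  assumes irrefl: "irreflp_on D lt" and trans: "transp_on D lt" and total: "totalp_on D lt"
begin

text \<open>One instance suffices, under the same parameters: \<open>Neg \<phi>\<close> defines the
  counterexamples.\<close>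

lemma D_Inf_imp_DCI:
  assumes "sat D lt e (D_Inf (Neg \<phi>))"
  shows "sat D lt e (DCI \<phi>)"
proof -
  define P where "P x = sat D lt (case_nat x e) \<phi>" for x
  have inf: "\<exists>z\<in>D. \<forall>y\<in>D. (\<forall>x\<in>D. \<not> P x \<longrightarrow> lt\<^sup>=\<^sup>= y x) \<longleftrightarrow> lt\<^sup>=\<^sup>= y z"
    if "\<exists>x\<in>D. \<not> P x" "\<exists>y\<in>D. \<forall>x\<in>D. \<not> P x \<longrightarrow> lt\<^sup>=\<^sup>= y x"
    using assms that by (simp add: sat_D_Inf Let_def P_def)
  \<comment> \<open>By totality, a counterexample that is not strictly below \<open>y\<close> lies
    at or above it.\<close>
  have lbI: "\<forall>x\<in>D. \<not> P x \<longrightarrow> lt\<^sup>=\<^sup>= y x" if "y \<in> D" "\<forall>x\<in>D. lt x y \<longrightarrow> P x" for y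
    using that total by (auto dest: totalp_onD)
  have "P a" if a: "a \<in> D" and start: "\<exists>x\<in>D. \<forall>y\<in>D. lt y x \<longrightarrow> P y"
    and step: "\<forall>x\<in>D. (\<forall>y\<in>D. lt y x \<longrightarrow> P y) \<longrightarrow> (\<exists>z\<in>D. lt x z \<and> (\<forall>y\<in>D. lt y z \<longrightarrow> P y))" for a
  proof (rule ccontr)
    assume "\<not> P a"
    with a have "\<exists>x\<in>D. \<not> P x" by blast
    moreover obtain b where "b \<in> D" "\<forall>x\<in>D. \<not> P x \<longrightarrow> lt\<^sup>=\<^sup>= b x"
      using start lbI by blast
    ultimately obtain z where z: "z \<in> D" "\<forall>y\<in>D. (\<forall>x\<in>D. \<not> P x \<longrightarrow> lt\<^sup>=\<^sup>= y x) \<longleftrightarrow> lt\<^sup>=\<^sup>= y z"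
      using inf by blast
    have asym: "\<not> (lt x y \<and> lt\<^sup>=\<^sup>= y x)" if "x \<in> D" "y \<in> D" for x y
      using that irrefl trans unfolding sup_apply sup_bool_def by (metis irreflp_onD transp_onD)
    \<comment> \<open>Taking \<open>y = z\<close> in the equivalence shows that \<open>z\<close> is
      itself a lower bound, so no counterexample lies strictly below it.\<close>
    have "\<forall>y\<in>D. lt y z \<longrightarrow> P y"
      using z asym by blast
    then obtain w where w: "w \<in> D" "lt z w" "\<forall>y\<in>D. lt y w \<longrightarrow> P y"
      using step z(1) by blast
    then have "lt\<^sup>=\<^sup>= w z"
      using z(2) lbI by blast
    with w z(1) asym show False by blast
  qed
  then show ?thesis
    by (simp add: sat_DCI Let_def P_def)
qed

text \<open>The instance says that its distinguished variable is a lower bound of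
  \<open>\<phi>\<close>. Inside \<open>All\<close> that variable has index 1, and
  \<open>inst 2 0\<close> moves the parameters of \<open>\<phi>\<close> past both indices.\<close>

lemma DCI_imp_D_Inf:
  assumes "sat D lt e (DCI (All (Imp (inst 2 0 \<phi>) (Leq 1 0))))"
  shows "sat D lt e (D_Inf \<phi>)"
proof -
  define P where "P x = sat D lt (case_nat x e) \<phi>" for x
  define lb where "lb y \<longleftrightarrow> (\<forall>x\<in>D. P x \<longrightarrow> lt\<^sup>=\<^sup>= y x)" for y
  have dci: "\<forall>x\<in>D. lb x" if "\<exists>x\<in>D. \<forall>y\<in>D. lt y x \<longrightarrow> lb y"
    "\<forall>x\<in>D. (\<forall>y\<in>D. lt y x \<longrightarrow> lb y) \<longrightarrow> (\<exists>z\<in>D. lt x z \<and> (\<forall>y\<in>D. lt y z \<longrightarrow> lb y))"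
    using assms that
    by (simp add: sat_DCI Let_def lb_def P_def sat_inst sat_Leq numeral_2_eq_2)
  have down: "lb y" if "lb z" "y \<in> D" "z \<in> D" "lt\<^sup>=\<^sup>= y z" for y z
    using that trans unfolding lb_def sup_apply sup_bool_def by (metis transp_onD)
  have "\<exists>z\<in>D. \<forall>y\<in>D. lb y \<longleftrightarrow> lt\<^sup>=\<^sup>= y z"
    if a: "a \<in> D" "P a" and b: "b \<in> D" "lb b" for a b
  proof (rule ccontr)
    assume no_inf: "\<not> (\<exists>z\<in>D. \<forall>y\<in>D. lb y \<longleftrightarrow> lt\<^sup>=\<^sup>= y z)"
    \<comment> \<open>Since lower bounds are closed downwards, the equivalence can fail at a lower
      bound \<open>z\<close> only through a lower bound not \<open>\<le> z\<close>.\<close>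
    have greater: "\<exists>w\<in>D. lt z w \<and> lb w" if "z \<in> D" "lb z" for z
    proof -
      from no_inf that obtain y where "y \<in> D" "lb y" "\<not> lt\<^sup>=\<^sup>= y z"
        using down by metis
      then show ?thesis
        using total that by (auto dest: totalp_onD)
    qed
    \<comment> \<open>A lower bound satisfying \<open>P\<close> would be a minimum of
      \<open>P\<close>, hence its infimum.\<close>
    have no_min: "\<not> lb x" if "x \<in> D" "P x" for x
    proof
      assume "lb x"
      then have "\<forall>y\<in>D. lb y \<longleftrightarrow> lt\<^sup>=\<^sup>= y x"
        using down that unfolding lb_def by blast
      with no_inf that show False by blast
    qed
    have "\<exists>z\<in>D. lt x z \<and> (\<forall>y\<in>D. lt y z \<longrightarrow> lb y)" if x: "x \<in> D" "\<forall>y\<in>D. lt y x \<longrightarrow> lb y" for x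
    proof -
      \<comment> \<open>Otherwise, by totality, some element satisfying \<open>P\<close> lies
        strictly below \<open>x\<close>; it is then a lower bound, against
        \<open>no_min\<close>.\<close>
      have "lb x"
        using x no_min total unfolding lb_def sup_apply sup_bool_def by (metis totalp_onD)
      then obtain w where "w \<in> D" "lt x w" "lb w"
        using greater x(1) by blast
      then show ?thesis using down by blast
    qed
    moreover have "\<exists>x\<in>D. \<forall>y\<in>D. lt y x \<longrightarrow> lb y"
      using b down by blast
    ultimately have "lb a"
      using dci a by blast
    with no_min a show False by blast
  qed
  then have "(\<exists>x\<in>D. P x) \<and> (\<exists>y\<in>D. lb y) \<longrightarrow> (\<exists>z\<in>D. \<forall>y\<in>D. lb y \<longleftrightarrow> lt\<^sup>=\<^sup>= y z)"
    by blast
  then show ?thesis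
    unfolding sat_D_Inf Let_def P_def lb_def .
qed

end

theorem theorem3p6:
  fixes D :: "'a set" and lt :: "'a \<Rightarrow> 'a \<Rightarrow> bool"
  assumes "irreflp_on D lt" and "transp_on D lt" and "totalp_on D lt"
  shows "satisfies_scheme D lt D_Inf \<longleftrightarrow> satisfies_scheme D lt DCI"
  unfolding satisfies_scheme_def
  using D_Inf_imp_DCI[OF assms] DCI_imp_D_Inf[OF assms] by blast

end
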